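(* Let $g(x)=(I-A)x+b$, where $A\in\mathbb{R}^{d\times d}$ is symmetric positive definite and $b\in\mathbb{R}^d$. For the full-memory Type-I or Type-II Anderson mixing method with modified historical sequences (described in the context) applied to $x=g(x)$, one has $$\zeta_k^{(j)}=0\ \text{ for } j\le k-3\ (k\ge4),\qquad\text{and}\qquad \Gamma_k^{(j)}=0\ \text{ for } j\le k-2\ (k\ge3),$$ if the algorithm has not found the exact solution (i.e. $r_i\neq0$ for $0\le i\le k$).
   Context: Full-memory Anderson mixing with modified historical sequences: let $x_0\in\mathbb{R}^d$, mixing parameters $\beta_k>0$, and $r_k:=g(x_k)-x_k$. Put $v_j:=p_j$ for the Type-I method and $v_j:=q_j$ for the Type-II method, $P_k=(p_1,\dots,p_k)$, $Q_k=(q_1,\dots,q_k)$, $V_k=(v_1,\dots,v_k)$. Set $x_1=x_0+\beta_0r_0$. For $k\ge1$: Step 1: if $k=1$, $p_1=x_1-x_0$, $q_1=r_1-r_0$; if $k\ge2$, $p_k=(x_k-x_{k-1})-P_{k-1}\zeta_k$, $q_k=(r_k-r_{k-1})-Q_{k-1}\zeta_k$, where $\zeta_k=(\zeta_k^{(1)},\dots,\zeta_k^{(k-1)})^{\mathrm T}$ is determined by $q_k\perp\mathrm{range}(V_{k-1})$. Step 2: $\bar x_k=x_k-P_k\Gamma_k$, $\bar r_k=r_k-Q_k\Gamma_k$, $x_{k+1}=\bar x_k+\beta_k\bar r_k$, where $\Gamma_k=(\Gamma_k^{(1)},\dots,\Gamma_k^{(k)})^{\mathrm T}$ is determined by $\bar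 r_k\perp\mathrm{range}(V_k)$. *)

theory Defs
  imports "HOL-Analysis.Analysis"
begin

definition spd_matrix :: "real ^ 'n ^ 'n \<Rightarrow> bool" where
  "spd_matrix A \<longleftrightarrow> transpose A = A \<and> (\<forall>u. u \<noteq> 0 \<longrightarrow> 0 < u \<bullet> (A *v u))"

datatype am_type = Type_I | Type_II

definition residual :: "('a \<Rightarrow> 'a) \<Rightarrow> 'a \<Rightarrow> 'a::real_inner" where
  "residual g y = g y - y"

definition am_v :: "am_type \<Rightarrow> (nat \<Rightarrow> 'a) \<Rightarrow> (nat \<Rightarrow> 'a) \<Rightarrow> nat \<Rightarrow> 'a" where
  "am_v T p q = (case T of Type_I \<Rightarrow> p | Type_II \<Rightarrow> q)"

text \<open>
  The matrix with columns \<open>w 1, \<dots>, w m\<close> is represented by the sequence \<open>w\<close> together with \<open>m\<close>: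
  \<open>cols_mult w m c\<close> is its product with the coefficient vector \<open>(c 1, \<dots>, c m)\<close>, and
  \<open>cols_range w m\<close> is its range (column space).
\<close>

definition cols_mult :: "(nat \<Rightarrow> 'a) \<Rightarrow> nat \<Rightarrow> (nat \<Rightarrow> real) \<Rightarrow> 'a::real_inner" where
  "cols_mult w m c = (\<Sum>j = 1..m. c j *\<^sub>R w j)"

definition cols_range :: "(nat \<Rightarrow> 'a) \<Rightarrow> nat \<Rightarrow> 'a::real_inner set" where
  "cols_range w m = range (cols_mult w m)"

text \<open>
  Coefficients are indexed as \<open>\<zeta> k j\<close> (\<open>1 \<le> j \<le> k - 1\<close>) and \<open>\<Gamma> k j\<close> (\<open>1 \<le> j \<le> k\<close>); values
  outside these ranges are never used. The coefficient vectors are any vectors for which the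
  orthogonality conditions hold.
\<close>

definition am_step1 ::
  "am_type \<Rightarrow> ('a \<Rightarrow> 'a) \<Rightarrow> (nat \<Rightarrow> 'a) \<Rightarrow> (nat \<Rightarrow> 'a) \<Rightarrow> (nat \<Rightarrow> 'a::real_inner) \<Rightarrow>
   (nat \<Rightarrow> nat \<Rightarrow> real) \<Rightarrow> nat \<Rightarrow> bool" where
  "am_step1 T g x p q \<zeta> k \<longleftrightarrow>
    (let r = (\<lambda>i. residual g (x i)) in
     if k = 1 then p 1 = x 1 - x 0 \<and> q 1 = r 1 - r 0
     else p k = (x k - x (k - 1)) - cols_mult p (k - 1) (\<zeta> k)
        \<and> q k = (r k - r (k - 1)) - cols_mult q (k - 1) (\<zeta> k)
        \<and> (\<forall>u \<in> cols_range (am_v T p q) (k - 1). orthogonal (q k) u))"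

definition am_step2 ::
  "am_type \<Rightarrow> ('a \<Rightarrow> 'a) \<Rightarrow> (nat \<Rightarrow> real) \<Rightarrow> (nat \<Rightarrow> 'a) \<Rightarrow> (nat \<Rightarrow> 'a) \<Rightarrow> (nat \<Rightarrow> 'a::real_inner) \<Rightarrow>
   (nat \<Rightarrow> nat \<Rightarrow> real) \<Rightarrow> nat \<Rightarrow> bool" where
  "am_step2 T g \<beta> x p q \<Gamma> k \<longleftrightarrow>
    (let xbar = x k - cols_mult p k (\<Gamma> k);
         rbar = residual g (x k) - cols_mult q k (\<Gamma> k)
     in (\<forall>u \<in> cols_range (am_v T p q) k. orthogonal rbar u)
      \<and> x (k + 1) = xbar + \<beta> k *\<^sub>R rbar)"

text \<open>
  \<open>am_run T g \<beta> x p q \<zeta> \<Gamma> n\<close>: the sequences are produced by the initialisation and iterations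
  \<open>1, \<dots>, n\<close> of full-memory Anderson mixing with modified historical sequences. Only finitely
  many iterations are prescribed because the method may terminate.
\<close>

definition am_run ::
  "am_type \<Rightarrow> ('a \<Rightarrow> 'a) \<Rightarrow> (nat \<Rightarrow> real) \<Rightarrow> (nat \<Rightarrow> 'a) \<Rightarrow> (nat \<Rightarrow> 'a) \<Rightarrow> (nat \<Rightarrow> 'a::real_inner) \<Rightarrow>
   (nat \<Rightarrow> nat \<Rightarrow> real) \<Rightarrow> (nat \<Rightarrow> nat \<Rightarrow> real) \<Rightarrow> nat \<Rightarrow> bool" where
  "am_run T g \<beta> x p q \<zeta> \<Gamma> n \<longleftrightarrow>
     x 1 = x 0 + \<beta> 0 *\<^sub>R residual g (x 0)
   \<and> (\<forall>k. 1 \<le> k \<and> k \<le> n \<longrightarrow> am_step1 T g x p q \<zeta> k \<and> am_step2 T g \<beta> x p q \<Gamma> k)"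

end

theory Submission
  imports Defs
begin

text \<open>
  Since \<open>g\<close> is affine, residuals differ by \<open>- A\<close> times the difference of the iterates, hence
  \<open>q j = - A (p j)\<close>, and the vectors \<open>v j\<close> are the images of the \<open>p j\<close> under \<open>V = id\<close> (Type I) or
  \<open>V = - A\<close> (Type II). In both cases the form \<open>V u \<bullet> A w\<close> is symmetric and definite, so the
  first step of the method is a Gram--Schmidt process which makes the \<open>p j\<close> conjugate, and
  the second step makes the averaged residual \<open>rbar k\<close> orthogonal to \<open>V\<close> of the space
  \<open>S k\<close> spanned by \<open>p 1, \<dots>, p k\<close>. Both coefficient families can be read off by pairing with
  \<open>v j\<close>: up to the factor \<open>v j \<bullet> q j\<close>, \<open>\<Gamma> k j\<close> is \<open>v j \<bullet> r k\<close> and \<open>\<zeta> k j\<close> is \<open>v j \<bullet> (r k - r (k - 1))\<close>.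
  Everything therefore reduces to \<open>v j \<bullet> r m = 0\<close> for \<open>j \<le> m - 2\<close>
  (\<open>old_direction_orthogonal_residual\<close>), as for the Lanczos and conjugate residual recurrences.

  Because \<open>r m = rbar (m - 1) - \<beta> (m - 1) A (rbar (m - 1))\<close> and \<open>A\<close> is self-adjoint and commutes
  with \<open>V\<close>, that orthogonality follows once \<open>A (p j)\<close> lies in \<open>S (j + 1)\<close>: the spaces \<open>S m\<close> behave like
  Krylov spaces (\<open>A_direction_in_next\<close>). The latter, and the division by \<open>v j \<bullet> q j\<close>, need that no
  direction vanishes before the solution is found (\<open>direction_nonzero\<close>): if \<open>p m = 0\<close>, then
  \<open>rbar (m - 1)\<close> would itself belong to \<open>S (m - 1)\<close> and so be orthogonal to its own image under \<open>V\<close>, hence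
  be zero, and then \<open>r m = 0\<close>.
\<close>

section \<open>Linear combinations of the columns\<close>

lemma cols_mult_in_span: "cols_mult w m c \<in> span (w ` {1..m})"
  unfolding cols_mult_def by (intro span_sum span_scale span_base) auto

lemma column_in_cols_range:
  assumes "1 \<le> j" "j \<le> m"
  shows "w j \<in> cols_range w m"
proof -
  have "cols_mult w m (\<lambda>i. if i = j then 1 else 0) = (\<Sum>i = 1..m. if i = j then w i else 0)"
    unfolding cols_mult_def by (intro sum.cong) auto
  also have "\<dots> = w j"
    using assms by simp
  finally show ?thesis
    unfolding cols_range_def by (metis rangeI)
qed

lemma linear_cols_mult:
  assumes "linear f"
  shows "f (cols_mult w m c) = cols_mult (\<lambda>j. f (w j)) m c"
  unfolding cols_mult_def by (simp add: linear_sum[OF assms] linear_cmul[OF assms])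

section \<open>Conjugate directions and averaged residuals\<close>

text \<open>
  The two types of the method differ only in the operator \<open>V\<close>. Since \<open>q j = - A (p j)\<close>, the
  averaged residual \<open>r m - Q\<^sub>m \<Gamma>\<^sub>m\<close> is expressed through \<open>A\<close> and the \<open>p j\<close>. Starting at index \<open>0\<close> with empty
  column matrices makes the initialisation an instance of the general step.
\<close>

locale conjugate_mixing =
  fixes A V :: "'a::real_inner \<Rightarrow> 'a"
    and \<beta> :: "nat \<Rightarrow> real"
    and x r p :: "nat \<Rightarrow> 'a"
    and \<zeta> \<Gamma> :: "nat \<Rightarrow> nat \<Rightarrow> real"
    and rbar :: "nat \<Rightarrow> 'a"
    and n :: nat
  defines "rbar \<equiv> \<lambda>m. r m + A (cols_mult p m (\<Gamma> m))"
  assumes linear_A: "linear A" and linear_V: "linear V"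
    and A_self_adjoint: "u \<bullet> A w = A u \<bullet> w"
    and V_A_commute: "V (A u) = A (V u)"
    and VA_sym: "V u \<bullet> A w = V w \<bullet> A u"
    and VA_definite: "V u \<bullet> A u = 0 \<Longrightarrow> u = 0"
    and V_definite: "V u \<bullet> u = 0 \<Longrightarrow> u = 0"
    and \<beta>_nonzero: "\<beta> i \<noteq> 0"
    and residual_diff: "r i - r j = - A (x i - x j)"
    and residual_nonzero: "i \<le> n \<Longrightarrow> r i \<noteq> 0"
    and direction: "1 \<le> m \<Longrightarrow> m \<le> n \<Longrightarrow>
          p m = x m - x (m - 1) - cols_mult p (m - 1) (\<zeta> m)"
    and conjugate: "1 \<le> j \<Longrightarrow> j < m \<Longrightarrow> m \<le> n \<Longrightarrow> V (p j) \<bullet> A (p m) = 0"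
    and iterate: "1 \<le> m \<Longrightarrow> m \<le> n \<Longrightarrow>
          x m = x (m - 1) - cols_mult p (m - 1) (\<Gamma> (m - 1)) + \<beta> (m - 1) *\<^sub>R rbar (m - 1)"
    and averaged_orthogonal: "1 \<le> j \<Longrightarrow> j \<le> m \<Longrightarrow> m \<le> n \<Longrightarrow> V (p j) \<bullet> rbar m = 0"
begin

definition S :: "nat \<Rightarrow> 'a set" where
  "S m = span (p ` {1..m})"

lemma S_mono: "i \<le> m \<Longrightarrow> S i \<subseteq> S m"
  unfolding S_def by (intro span_mono) auto

lemma direction_in_S: "1 \<le> j \<Longrightarrow> j \<le> m \<Longrightarrow> p j \<in> S m"
  unfolding S_def by (intro span_base) auto

lemma S_add: "u \<in> S m \<Longrightarrow> w \<in> S m \<Longrightarrow> u + w \<in> S m"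
  and S_diff: "u \<in> S m \<Longrightarrow> w \<in> S m \<Longrightarrow> u - w \<in> S m"
  and S_scale: "u \<in> S m \<Longrightarrow> c *\<^sub>R u \<in> S m"
  unfolding S_def by (auto intro: span_add span_diff span_scale)

lemma S_scale_iff: "c \<noteq> 0 \<Longrightarrow> c *\<^sub>R u \<in> S m \<longleftrightarrow> u \<in> S m"
  using S_scale[of u m c] S_scale[of "c *\<^sub>R u" m "inverse c"] by auto

lemma cols_mult_in_S: "cols_mult p m c \<in> S m"
  unfolding S_def by (rule cols_mult_in_span)

lemma S_induct:
  assumes "linear f" "subspace W" and "\<And>j. 1 \<le> j \<Longrightarrow> j \<le> m \<Longrightarrow> f (p j) \<in> W" and "u \<in> S m"
  shows "f u \<in> W"
  using assms(4) unfolding S_def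
proof (induction rule: span_induct_alt)
  case base
  show ?case
    using assms(1,2) by (simp add: linear_0 subspace_0)
next
  case (step c w u)
  then show ?case
    using assms(1-3)
    by (auto simp: linear_add linear_cmul intro!: subspace_add subspace_scale)
qed

lemma V_orthogonal_S:
  assumes "\<And>j. 1 \<le> j \<Longrightarrow> j \<le> m \<Longrightarrow> V (p j) \<bullet> w = 0" and "u \<in> S m"
  shows "V u \<bullet> w = 0"
  using S_induct[OF linear_V subspace_hyperplane[of w], of m u] assms
  by (simp add: inner_commute)

lemma averaged_orthogonal_S: "m \<le> n \<Longrightarrow> u \<in> S m \<Longrightarrow> V u \<bullet> rbar m = 0"
  by (rule V_orthogonal_S[of m]) (auto intro: averaged_orthogonal)

lemma direction_averaged_residual:
  assumes "1 \<le> m" "m \<le> n"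
  shows "p m - \<beta> (m - 1) *\<^sub>R rbar (m - 1) \<in> S (m - 1)"
proof -
  have "p m - \<beta> (m - 1) *\<^sub>R rbar (m - 1)
      = - 1 *\<^sub>R cols_mult p (m - 1) (\<Gamma> (m - 1)) - cols_mult p (m - 1) (\<zeta> m)"
    using direction[OF assms] iterate[OF assms] by (simp add: algebra_simps)
  then show ?thesis
    by (metis S_diff S_scale cols_mult_in_S)
qed

lemma residual_update:
  assumes "1 \<le> m" "m \<le> n"
  shows "r m = rbar (m - 1) - \<beta> (m - 1) *\<^sub>R A (rbar (m - 1))"
proof -
  have "x m - x (m - 1) = \<beta> (m - 1) *\<^sub>R rbar (m - 1) - cols_mult p (m - 1) (\<Gamma> (m - 1))"
    using iterate[OF assms] by simp
  then have "r m - r (m - 1)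
      = A (cols_mult p (m - 1) (\<Gamma> (m - 1))) - \<beta> (m - 1) *\<^sub>R A (rbar (m - 1))"
    using residual_diff[of m "m - 1"] by (simp add: linear_diff[OF linear_A] linear_cmul[OF linear_A])
  then show ?thesis
    unfolding rbar_def by (simp add: algebra_simps)
qed

text \<open>
  A vanishing direction would put \<open>rbar (m - 1)\<close> into the very space to whose image under \<open>V\<close>
  it is orthogonal; definiteness of \<open>V\<close> then gives \<open>rbar (m - 1) = 0\<close>, so that \<open>x m\<close> is a solution.
  This is where the assumption of non-termination enters.
\<close>

lemma direction_nonzero:
  assumes "1 \<le> m" "m \<le> n"
  shows "p m \<noteq> 0"
proof
  assume "p m = 0"
  then have "(- \<beta> (m - 1)) *\<^sub>R rbar (m - 1) \<in> S (m - 1)"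
    using direction_averaged_residual[OF assms] by simp
  then have "rbar (m - 1) \<in> S (m - 1)"
    using \<beta>_nonzero S_scale_iff by (metis neg_equal_0_iff_equal)
  then have "rbar (m - 1) = 0"
    using averaged_orthogonal_S assms V_definite by simp
  then have "r m = 0"
    using residual_update[OF assms] linear_0[OF linear_A] by simp
  then show False
    using residual_nonzero assms by simp
qed

lemma direction_new:
  assumes "1 \<le> m" "m \<le> n"
  shows "p m \<notin> S (m - 1)"
proof
  have "V (p j) \<bullet> A (p m) = 0" if "1 \<le> j" "j \<le> m - 1" for j
    using that assms by (intro conjugate) auto
  moreover assume "p m \<in> S (m - 1)"
  ultimately have "V (p m) \<bullet> A (p m) = 0"
    by (rule V_orthogonal_S)
  then show False
    using VA_definite direction_nonzero[OF assms] by blast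
qed

section \<open>Krylov structure of the spanned spaces\<close>

text \<open>
  Modulo \<open>S (j - 1)\<close>, the direction \<open>p j\<close> is a multiple of \<open>rbar (j - 1)\<close>, whose image under \<open>A\<close> is
  governed by \<open>r j\<close>; and \<open>r j\<close> differs from \<open>rbar j\<close>, a multiple of \<open>p (j + 1)\<close>, by
  \<open>A\<close> of a combination of \<open>p 1, \<dots>, p j\<close>. The last term brings back \<open>A (p j)\<close> with the
  factor \<open>\<Gamma> j j\<close>, which leaves \<open>(1 - \<Gamma> j j) A (p j) \<in> S (j + 1)\<close>. The factor cannot
  vanish: otherwise \<open>rbar j\<close>, and with it \<open>p (j + 1)\<close>, would already lie in \<open>S j\<close>.
\<close>

lemma A_direction_in_next:
  assumes "1 \<le> j" "j + 1 \<le> n"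
  shows "A (p j) \<in> S (j + 1)"
  using assms
proof (induction j rule: less_induct)
  case (less j)
  then have j: "1 \<le> j" "j \<le> n" "j + 1 \<le> n"
    by auto
  have A_lower: "A u \<in> S j" if "u \<in> S (j - 1)" for u
  proof (rule S_induct[OF linear_A _ _ that])
    show "subspace (S j)"
      unfolding S_def by (rule subspace_span)
    fix i assume "1 \<le> i" "i \<le> j - 1"
    then have "i < j" "i + 1 \<le> n" "i + 1 \<le> j"
      using j by auto
    then show "A (p i) \<in> S j"
      using less.IH[of i] \<open>1 \<le> i\<close> S_mono[of "i + 1" j] by blast
  qed
  define s where "s = p j - \<beta> (j - 1) *\<^sub>R rbar (j - 1)"
  have s: "s \<in> S (j - 1)"
    unfolding s_def using direction_averaged_residual j by blast
  define t where "t = cols_mult p (j - 1) (\<Gamma> j)"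
  have t: "t \<in> S (j - 1)"
    unfolding t_def by (rule cols_mult_in_S)
  have "{1..j} = insert j {1..j - 1}"
    using j by auto
  then have split_last: "cols_mult p j (\<Gamma> j) = \<Gamma> j j *\<^sub>R p j + t"
    using j unfolding t_def cols_mult_def by simp
  have "\<beta> (j - 1) *\<^sub>R rbar (j - 1) = p j - s"
    unfolding s_def by simp
  also have "\<dots> \<in> S j"
    using s S_mono[of "j - 1" j] j by (intro S_diff direction_in_S) auto
  finally have rbar_prev: "rbar (j - 1) \<in> S j"
    using S_scale_iff \<beta>_nonzero by blast
  have "A (p j) = \<beta> (j - 1) *\<^sub>R A (rbar (j - 1)) + A s"
    unfolding s_def by (simp add: linear_diff[OF linear_A] linear_cmul[OF linear_A])
  also have "\<dots> = rbar (j - 1) - r j + A s"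
    using residual_update[OF j(1,2)] by simp
  also have "r j = rbar j - (\<Gamma> j j *\<^sub>R A (p j) + A t)"
    unfolding rbar_def split_last by (simp add: linear_add[OF linear_A] linear_cmul[OF linear_A])
  finally have key: "(1 - \<Gamma> j j) *\<^sub>R A (p j) = (rbar (j - 1) + A s + A t) - rbar j"
    by (simp add: algebra_simps)
  have lower: "rbar (j - 1) + A s + A t \<in> S j"
    using rbar_prev A_lower s t by (intro S_add) auto
  have next_dir: "p (j + 1) - \<beta> j *\<^sub>R rbar j \<in> S j"
    using direction_averaged_residual[of "j + 1"] j by simp
  have "1 - \<Gamma> j j \<noteq> 0"
  proof
    assume "1 - \<Gamma> j j = 0"
    then have "rbar j \<in> S j"
      using key lower by simp
    then have "(p (j + 1) - \<beta> j *\<^sub>R rbar j) + \<beta> j *\<^sub>R rbar j \<in> S j"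
      using next_dir by (intro S_add S_scale)
    then show False
      using direction_new[of "j + 1"] j by simp
  qed
  moreover have "rbar j \<in> S (j + 1)"
  proof -
    have "p (j + 1) - (p (j + 1) - \<beta> j *\<^sub>R rbar j) \<in> S (j + 1)"
    proof (rule S_diff)
      show "p (j + 1) \<in> S (j + 1)"
        by (rule direction_in_S) auto
      show "p (j + 1) - \<beta> j *\<^sub>R rbar j \<in> S (j + 1)"
        using next_dir S_mono[of j "j + 1"] by (metis le_add1 subsetD)
    qed
    then have "\<beta> j *\<^sub>R rbar j \<in> S (j + 1)"
      by simp
    then show ?thesis
      using S_scale_iff \<beta>_nonzero by blast
  qed
  then have "(1 - \<Gamma> j j) *\<^sub>R A (p j) \<in> S (j + 1)"
    unfolding key using lower S_mono[of j "j + 1"] by (intro S_diff) auto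
  ultimately show ?case
    using S_scale_iff by blast
qed

text \<open>
  Moving \<open>A\<close> to the other side of the inner product in \<open>residual_update\<close> costs one index,
  which is why the most recent direction \<open>p (m - 1)\<close> is excluded.
\<close>

lemma old_direction_orthogonal_residual:
  assumes "1 \<le> j" "j + 2 \<le> m" "m \<le> n"
  shows "V (p j) \<bullet> r m = 0"
proof -
  have "p j \<in> S (m - 1)"
    using assms by (intro direction_in_S) auto
  have "j + 1 \<le> n" "j + 1 \<le> m - 1"
    using assms by auto
  then have "A (p j) \<in> S (m - 1)"
    using A_direction_in_next[of j] S_mono[of "j + 1" "m - 1"] assms(1) by blast
  then have "V (p j) \<bullet> rbar (m - 1) = 0" "V (A (p j)) \<bullet> rbar (m - 1) = 0"
    using \<open>p j \<in> S (m - 1)\<close> averaged_orthogonal_S assms by auto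
  then show ?thesis
    using residual_update[of m] assms
    by (simp add: inner_diff_right A_self_adjoint V_A_commute)
qed

section \<open>Reading off the coefficients\<close>

lemma conjugate_coefficient:
  assumes "1 \<le> j" "j \<le> m" "m \<le> n"
  shows "V (p j) \<bullet> A (cols_mult p m c) = c j * (V (p j) \<bullet> A (p j))"
proof -
  have off_diagonal: "V (p j) \<bullet> A (p i) = 0" if "i \<in> {1..m}" "i \<noteq> j" for i
    using that assms conjugate[of j i] conjugate[of i j] VA_sym[of "p i" "p j"]
    by (cases "i < j") auto
  have "V (p j) \<bullet> A (cols_mult p m c) = (\<Sum>i = 1..m. c i * (V (p j) \<bullet> A (p i)))"
    unfolding linear_cols_mult[OF linear_A] by (simp add: cols_mult_def inner_sum_right)
  also have "\<dots> = (\<Sum>i = 1..m. if i = j then c j * (V (p j) \<bullet> A (p j)) else 0)"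
    using off_diagonal by (intro sum.cong) auto
  also have "\<dots> = c j * (V (p j) \<bullet> A (p j))"
    using assms by simp
  finally show ?thesis .
qed

lemma coefficient_zero:
  assumes "1 \<le> j" "j \<le> m" "m \<le> n" "V (p j) \<bullet> A (cols_mult p m c) = 0"
  shows "c j = 0"
  using conjugate_coefficient[OF assms(1-3), of c] assms direction_nonzero[of j] VA_definite[of "p j"]
  by auto

lemma \<Gamma>_zero:
  assumes "1 \<le> j" "j + 2 \<le> m" "m \<le> n"
  shows "\<Gamma> m j = 0"
proof (rule coefficient_zero)
  have "V (p j) \<bullet> rbar m = 0"
    using averaged_orthogonal assms by simp
  then show "V (p j) \<bullet> A (cols_mult p m (\<Gamma> m)) = 0"
    using old_direction_orthogonal_residual[OF assms] by (simp add: rbar_def inner_add_right)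
qed (use assms in auto)

text \<open>
  Here \<open>V (p j)\<close> must be orthogonal to \<open>r (m - 1)\<close> as well as to \<open>r m\<close>; the older residual
  costs one index more than in the case of \<open>\<Gamma>\<close>.
\<close>

lemma \<zeta>_zero:
  assumes "1 \<le> j" "j + 3 \<le> m" "m \<le> n"
  shows "\<zeta> m j = 0"
proof (rule coefficient_zero)
  have "A (cols_mult p (m - 1) (\<zeta> m)) = A (x m - x (m - 1)) - A (p m)"
    using direction[of m] assms by (simp flip: linear_diff[OF linear_A])
  also have "\<dots> = r (m - 1) - r m - A (p m)"
    using residual_diff[of m "m - 1"] by (simp add: algebra_simps)
  finally show "V (p j) \<bullet> A (cols_mult p (m - 1) (\<zeta> m)) = 0"
    using assms conjugate[of j m] old_direction_orthogonal_residual[of j m]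
      old_direction_orthogonal_residual[of j "m - 1"]
    by (simp add: inner_diff_right)
qed (use assms in auto)

end

section \<open>Anderson mixing for an affine map\<close>

text \<open>
  The orthogonality conditions only involve \<open>q\<close> and the columns \<open>v\<close>; this identity is what turns
  them into conjugacy of the directions \<open>p\<close>.
\<close>

lemma am_run_residual_direction:
  fixes A :: "'a::real_inner \<Rightarrow> 'a"
  assumes "linear A"
    and diff: "\<And>y z. residual g y - residual g z = - A (y - z)"
    and run: "am_run T g \<beta> x p q \<zeta> \<Gamma> n"
    and "1 \<le> m" "m \<le> n"
  shows "q m = - A (p m)"
  using \<open>1 \<le> m\<close> \<open>m \<le> n\<close>
proof (induction m rule: less_induct)
  case (less m)
  have step: "am_step1 T g x p q \<zeta> m"
    using run less.prems unfolding am_run_def by blast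
  show ?case
  proof (cases "m = 1")
    case True
    then show ?thesis
      using step diff by (simp add: am_step1_def Let_def)
  next
    case False
    have "cols_mult q (m - 1) (\<zeta> m) = cols_mult (\<lambda>j. - A (p j)) (m - 1) (\<zeta> m)"
      unfolding cols_mult_def using less by (intro sum.cong) auto
    also have "\<dots> = - A (cols_mult p (m - 1) (\<zeta> m))"
      unfolding linear_cols_mult[OF \<open>linear A\<close>] by (simp add: cols_mult_def sum_negf)
    finally show ?thesis
      using step False diff[of "x m" "x (m - 1)"]
      by (simp add: am_step1_def Let_def linear_diff[OF \<open>linear A\<close>])
  qed
qed

lemma am_run_conjugate_mixing:
  fixes A V :: "'a::real_inner \<Rightarrow> 'a"
  assumes "linear A" "linear V"
    and "\<And>u w. u \<bullet> A w = A u \<bullet> w"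
    and "\<And>u. V (A u) = A (V u)"
    and "\<And>u w. V u \<bullet> A w = V w \<bullet> A u"
    and "\<And>u. V u \<bullet> A u = 0 \<Longrightarrow> u = 0"
    and "\<And>u. V u \<bullet> u = 0 \<Longrightarrow> u = 0"
    and "\<And>i. \<beta> i \<noteq> 0"
    and diff: "\<And>y z. residual g y - residual g z = - A (y - z)"
    and run: "am_run T g \<beta> x p q \<zeta> \<Gamma> n"
    and "\<And>i. i \<le> n \<Longrightarrow> residual g (x i) \<noteq> 0"
    and v: "\<And>j. 1 \<le> j \<Longrightarrow> j \<le> n \<Longrightarrow> am_v T p q j = V (p j)"
  shows "conjugate_mixing A V \<beta> x (\<lambda>i. residual g (x i)) p \<zeta> \<Gamma> n"
proof -
  have q: "q j = - A (p j)" if "1 \<le> j" "j \<le> n" for j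
    using am_run_residual_direction[OF \<open>linear A\<close> diff run that] .
  have step1: "am_step1 T g x p q \<zeta> m" and step2: "am_step2 T g \<beta> x p q \<Gamma> m"
    if "1 \<le> m" "m \<le> n" for m
    using run that unfolding am_run_def by blast+
  have averaged: "residual g (x m) - cols_mult q m (\<Gamma> m)
      = residual g (x m) + A (cols_mult p m (\<Gamma> m))" if "m \<le> n" for m
  proof -
    have "cols_mult q m (\<Gamma> m) = cols_mult (\<lambda>j. - A (p j)) m (\<Gamma> m)"
      unfolding cols_mult_def using that q by (intro sum.cong) auto
    then show ?thesis
      unfolding linear_cols_mult[OF \<open>linear A\<close>] by (simp add: cols_mult_def sum_negf)
  qed
  have direction: "p m = x m - x (m - 1) - cols_mult p (m - 1) (\<zeta> m)" if "1 \<le> m" "m \<le> n" for m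
    using step1[OF that] by (cases "m = 1") (auto simp: am_step1_def Let_def cols_mult_def)
  have conjugate: "V (p j) \<bullet> A (p m) = 0" if "1 \<le> j" "j < m" "m \<le> n" for j m
  proof -
    have "am_v T p q j \<in> cols_range (am_v T p q) (m - 1)"
      using that by (intro column_in_cols_range) auto
    then have "q m \<bullet> am_v T p q j = 0"
      using step1[of m] that by (auto simp: am_step1_def Let_def orthogonal_def)
    then show ?thesis
      using v[of j] q[of m] that by (simp add: inner_commute)
  qed
  have iterate: "x m = x (m - 1) - cols_mult p (m - 1) (\<Gamma> (m - 1))
      + \<beta> (m - 1) *\<^sub>R (residual g (x (m - 1)) + A (cols_mult p (m - 1) (\<Gamma> (m - 1))))"
    if "1 \<le> m" "m \<le> n" for m
  proof (cases "m = 1")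
    case True
    then show ?thesis
      using run linear_0[OF \<open>linear A\<close>] by (simp add: am_run_def cols_mult_def)
  next
    case False
    then show ?thesis
      using step2[of "m - 1"] averaged[of "m - 1"] that by (simp add: am_step2_def Let_def)
  qed
  have averaged_orthogonal:
    "V (p j) \<bullet> (residual g (x m) + A (cols_mult p m (\<Gamma> m))) = 0" if "1 \<le> j" "j \<le> m" "m \<le> n" for j m
  proof -
    have "am_v T p q j \<in> cols_range (am_v T p q) m"
      using that by (intro column_in_cols_range) auto
    then have "(residual g (x m) - cols_mult q m (\<Gamma> m)) \<bullet> am_v T p q j = 0"
      using step2[of m] that by (auto simp: am_step2_def Let_def orthogonal_def)
    then show ?thesis
      using v[of j] averaged[of m] that by (simp add: inner_commute)
  qed
  show ?thesis
    by (rule conjugate_mixing.intro)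
      (fact assms(1-8) diff assms(11) direction conjugate iterate averaged_orthogonal)+
qed

theorem proposition6p1:
  fixes A :: "real ^ 'd ^ 'd" and b :: "real ^ 'd"
    and g :: "real ^ 'd \<Rightarrow> real ^ 'd"
    and T :: am_type
    and \<beta> :: "nat \<Rightarrow> real"
    and x p q :: "nat \<Rightarrow> real ^ 'd"
    and \<zeta> \<Gamma> :: "nat \<Rightarrow> nat \<Rightarrow> real"
    and k :: nat
  assumes "spd_matrix A"
    and "\<And>y. g y = (mat 1 - A) *v y + b"
    and "\<And>i. 0 < \<beta> i"
    and "am_run T g \<beta> x p q \<zeta> \<Gamma> k"
    and "\<And>i. i \<le> k \<Longrightarrow> residual g (x i) \<noteq> 0"
  shows "(4 \<le> k \<longrightarrow> (\<forall>j. 1 \<le> j \<and> j \<le> k - 3 \<longrightarrow> \<zeta> k j = 0))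
       \<and> (3 \<le> k \<longrightarrow> (\<forall>j. 1 \<le> j \<and> j \<le> k - 2 \<longrightarrow> \<Gamma> k j = 0))"
proof -
  let ?A = "\<lambda>u. A *v u"
  define V :: "real ^ 'd \<Rightarrow> real ^ 'd" where
    "V = (case T of Type_I \<Rightarrow> (\<lambda>u. u) | Type_II \<Rightarrow> (\<lambda>u. - (A *v u)))"
  have lin: "linear ?A"
    by (rule matrix_vector_mul_linear)
  have sym: "u \<bullet> ?A w = ?A u \<bullet> w" for u w
    using assms(1) by (metis spd_matrix_def dot_lmul_matrix transpose_matrix_vector)
  have definite: "u = 0" if "u \<bullet> ?A u = 0" for u
    using that assms(1) unfolding spd_matrix_def by (metis less_irrefl)
  have injective: "u = 0" if "?A u = 0" for u
    using definite that by simp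
  have diff: "residual g y - residual g z = - ?A (y - z)" for y z
    by (simp add: residual_def assms(2) algebra_simps)
  have q: "q j = - ?A (p j)" if "1 \<le> j" "j \<le> k" for j
    using am_run_residual_direction[OF lin diff assms(4) that] .
  interpret conjugate_mixing ?A V \<beta> x "\<lambda>i. residual g (x i)" p \<zeta> \<Gamma>
    "\<lambda>m. residual g (x m) + ?A (cols_mult p m (\<Gamma> m))" k
  proof (rule am_run_conjugate_mixing[OF lin _ _ _ _ _ _ _ diff assms(4)])
    show "linear V"
      unfolding V_def using lin by (cases T) (auto simp: linear_compose_neg linear_id[unfolded id_def])
    show "V (?A u) = ?A (V u)" for u
      unfolding V_def by (cases T) (auto simp: linear_neg[OF lin])
    show "V u \<bullet> ?A w = V w \<bullet> ?A u" for u w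
      unfolding V_def using sym by (cases T) (auto simp: inner_commute)
    show "u = 0" if "V u \<bullet> ?A u = 0" for u
      using that definite injective unfolding V_def by (cases T) auto
    show "u = 0" if "V u \<bullet> u = 0" for u
      using that definite unfolding V_def by (cases T) (auto simp: inner_commute)
    show "\<beta> i \<noteq> 0" for i
      using assms(3)[of i] by simp
    show "am_v T p q j = V (p j)" if "1 \<le> j" "j \<le> k" for j
      unfolding V_def am_v_def using q[OF that] by (cases T) auto
  qed (use sym assms(5) in auto)
  show ?thesis
    using \<zeta>_zero[of _ k] \<Gamma>_zero[of _ k] by auto
qed

end
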